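(* Let $0<\alpha<1$. Then there exists a function $f:[0,1]\to\mathbb{R}$ that is of bounded variation and $\alpha$-Hölder continuous, such that its variation function $\mathrm{Var}_f$ is $\gamma$-Hölder continuous for no $\gamma\in(0,1)$.
   Context: For $f:[a,b]\to\mathbb{R}$, the variation is $$\mathrm{Var}(f;a,b):=\sup\Big\{\sum_{i=1}^n|f(x_i)-f(x_{i-1})| : a=x_0\le x_1\le\dots\le x_n=b \text{ for some } n\in\mathbb{N}\Big\}.$$ The function $f$ is of bounded variation if $\mathrm{Var}(f;a,b)<\infty$; in that case its variation function is $\mathrm{Var}_f:[a,b]\to\mathbb{R}$, $\mathrm{Var}_f(x):=\mathrm{Var}(f;a,x)$. A function $g:[a,b]\to\mathbb{R}$ is $\gamma$-Hölder continuous ($0<\gamma<1$) if there is a constant $L\geq 0$ with $|g(x)-g(y)|\le L|x-y|^\gamma$ for all $x,y\in[a,b]$. *)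

theory Defs
  imports "HOL-Analysis.Analysis"
begin

(* A function on [a,b] is represented by a total function on the reals; the notions
   below only depend on its values on [a,b]. The intended use is for a \<le> b: for a > b
   there is no partition, and the supremum of the empty set in ereal is -\<infinity>. *)

definition variation :: "(real \<Rightarrow> real) \<Rightarrow> real \<Rightarrow> real \<Rightarrow> ereal" where
  "variation f a b =
     Sup {ereal (\<Sum>i=1..n. \<bar>f (x i) - f (x (i - 1))\<bar>) | (n::nat) (x :: nat \<Rightarrow> real).
            x 0 = a \<and> x n = b \<and> (\<forall>i\<in>{1..n}. x (i - 1) \<le> x i)}"

definition bounded_variation_on :: "(real \<Rightarrow> real) \<Rightarrow> real \<Rightarrow> real \<Rightarrow> bool" where
  "bounded_variation_on f a b \<longleftrightarrow> variation f a b < \<infinity>"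

(* real_of_ereal sends infinite values to 0, so this is the variation function on [a,b]
   only when f is of bounded variation there. *)
definition variation_fun :: "(real \<Rightarrow> real) \<Rightarrow> real \<Rightarrow> real \<Rightarrow> real" where
  "variation_fun f a x = real_of_ereal (variation f a x)"

(* Intended for 0 < \<gamma> < 1. *)
definition holder_continuous_on :: "real \<Rightarrow> (real \<Rightarrow> real) \<Rightarrow> real \<Rightarrow> real \<Rightarrow> bool" where
  "holder_continuous_on \<gamma> g a b \<longleftrightarrow>
     (\<exists>L\<ge>0. \<forall>x\<in>{a..b}. \<forall>y\<in>{a..b}. \<bar>g x - g y\<bar> \<le> L * \<bar>x - y\<bar> powr \<gamma>)"

end

(* For a = \<alpha> / (1 - \<alpha>) take f x = x^a sin (x^-a) / (1 - ln x)^2. On (0,1] its derivative is bounded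
   by a constant times 1 / (x (1 - ln x)^2), the derivative of 1 / (1 - ln x), hence f has bounded
   variation. The bounds |f x| <= x^a and |f' x| <= C / x give Hoelder continuity with exponent
   a / (a + 1) = \<alpha>. Summing over N consecutive extrema of the sine, the variation on [0,t] is at
   least of order 1 / (ln t)^2, which is not O(t^\<gamma>) for any \<gamma> > 0. *)

theory Submission
  imports Defs "HOL-Real_Asymp.Real_Asymp"
begin

section \<open>Bounds on the variation from below and above\<close>

lemma sum_le_variation:
  fixes n :: nat and x :: "nat \<Rightarrow> real"
  assumes "x 0 = a" "x n = b" "\<forall>i\<in>{1..n}. x (i - 1) \<le> x i"
  shows "ereal (\<Sum>i=1..n. \<bar>f (x i) - f (x (i - 1))\<bar>) \<le> variation f a b"
  unfolding variation_def using assms by (intro Sup_upper) blast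

text \<open>Together with a finite upper bound this excludes both infinite values, so that
  \<open>real_of_ereal\<close> in \<open>variation_fun\<close> loses nothing.\<close>

lemma variation_nonneg:
  assumes "a \<le> b"
  shows "0 \<le> variation f a b"
proof -
  have "0 \<le> ereal (\<Sum>i=1..1. \<bar>f (if i = 0 then a else b) - f (if i - 1 = (0::nat) then a else b)\<bar>)"
    by simp
  also have "\<dots> \<le> variation f a b"
    using assms by (intro sum_le_variation) auto
  finally show ?thesis .
qed

text \<open>The increments of \<open>g\<close> telescope along any partition, so the resulting bound
  is the same for all of them.\<close>

lemma variation_le_of_dominated:
  assumes dom: "\<And>x y. a \<le> x \<Longrightarrow> x \<le> y \<Longrightarrow> y \<le> b \<Longrightarrow> \<bar>f y - f x\<bar> \<le> g y - g x"
  shows "variation f a b \<le> ereal (g b - g a)"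
  unfolding variation_def
proof (rule Sup_least, clarify)
  fix n :: nat and x :: "nat \<Rightarrow> real"
  assume a: "a = x 0" and b: "b = x n" and le: "\<forall>i\<in>{1..n}. x (i - 1) \<le> x i"
  \<comment> \<open>Monotonicity across several steps places every node between \<open>x 0\<close>
    and \<open>x n\<close>, where \<open>dom\<close> applies.\<close>
  have mono: "x i \<le> x j" if "i \<le> j" "j \<le> n" for i j
    using that
  proof (induction j rule: dec_induct)
    case (step m)
    then show ?case using le[rule_format, of "Suc m"] by simp
  qed simp
  have "(\<Sum>i=1..n. \<bar>f (x i) - f (x (i - 1))\<bar>) \<le> (\<Sum>i=1..n. g (x i) - g (x (i - 1)))"
    by (intro sum_mono dom) (auto simp: a b intro!: mono)
  also have "\<dots> = g (x n) - g (x 0)"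
    by (induction n) auto
  finally show "ereal (\<Sum>i=1..n. \<bar>f (x i) - f (x (i - 1))\<bar>) \<le> ereal (g (x n) - g (x 0))"
    by simp
qed

section \<open>The oscillating function and a majorant of its increments\<close>

text \<open>Since \<open>ln 0 = 0\<close> and \<open>0 powr p = 0\<close> in HOL, \<open>osc a 0 = 0\<close>, the continuous extension.\<close>

definition osc :: "real \<Rightarrow> real \<Rightarrow> real" where
  "osc a x = x powr a * sin (x powr - a) / (1 - ln x)\<^sup>2"

text \<open>The constant is the one in the derivative bound for \<open>osc\<close>. The separate
  value at 0 is the limit there; the formula itself would give \<open>2 * a + 2\<close>, because
  \<open>ln 0 = 0\<close>.\<close>

definition osc_majorant :: "real \<Rightarrow> real \<Rightarrow> real" where
  "osc_majorant a x = (if x = 0 then 0 else (2 * a + 2) / (1 - ln x))"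

lemma osc_0 [simp]: "osc a 0 = 0"
  by (simp add: osc_def)

lemma osc_majorant_has_derivative:
  assumes "0 < x" "x \<le> 1"
  shows "(osc_majorant a has_real_derivative (2 * a + 2) / (x * (1 - ln x)\<^sup>2)) (at x)"
proof -
  have l: "1 - ln x \<noteq> 0"
    using assms ln_le_zero_iff[of x] by linarith
  have "((\<lambda>x. (2 * a + 2) / (1 - ln x)) has_real_derivative (2 * a + 2) / (x * (1 - ln x)\<^sup>2)) (at x)"
    using assms l by (auto intro!: derivative_eq_intros simp: power2_eq_square field_simps)
  \<comment> \<open>The closed formula agrees with \<open>osc_majorant\<close> only away from 0, so
    the derivative is transferred through a neighbourhood of positive points.\<close>
  moreover have "eventually (\<lambda>y. y \<in> {0<..}) (nhds x)"
    using assms by (intro eventually_nhds_in_open) auto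
  then have "eventually (\<lambda>y. (2 * a + 2) / (1 - ln y) = osc_majorant a y) (nhds x)"
    by eventually_elim (simp add: osc_majorant_def)
  ultimately show ?thesis
    using DERIV_cong_ev[OF refl _ refl, of "\<lambda>y. (2 * a + 2) / (1 - ln y)" "osc_majorant a" x] by blast
qed

text \<open>The factor \<open>x powr a\<close> tames the inner derivative, of order
  \<open>x powr (- a - 1)\<close>, to order \<open>1 / x\<close>. Over the common denominator
  \<open>x * (1 - ln x)\<^sup>2\<close>, differentiating the power, the sine and the logarithmic
  factor contributes at most \<open>a\<close>, \<open>a\<close> and \<open>2\<close>.\<close>

lemma osc_has_derivative:
  assumes "0 < a" "0 < x" "x \<le> 1"
  obtains D where "(osc a has_real_derivative D) (at x)" "\<bar>D\<bar> \<le> (2 * a + 2) / (x * (1 - ln x)\<^sup>2)"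
proof -
  define l where "l = 1 - ln x"
  define s c p where "s = sin (x powr - a)" and "c = cos (x powr - a)" and "p = x powr a"
  have l: "1 \<le> l"
    using assms by (simp add: l_def)
  have p: "0 < p" "p \<le> 1"
    using assms by (auto simp: p_def powr_le1)
  have sc: "\<bar>s\<bar> \<le> 1" "\<bar>c\<bar> \<le> 1"
    by (auto simp: s_def c_def)
  define D where "D = (a * p * s - a * c + 2 * p * s / l) / (x * l\<^sup>2)"
  have pm: "x powr - a = 1 / p" "x powr (a - 1) = p / x" "x powr (- a - 1) = 1 / (p * x)"
    using assms by (auto simp: p_def powr_minus powr_diff field_simps)
  have "(osc a has_real_derivative
      ((a * x powr (a - 1) * s + p * (c * (- a * x powr (- a - 1)))) * l\<^sup>2 - p * s * (2 * l * (- 1 / x))) / (l\<^sup>2 * l\<^sup>2)) (at x)"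
  proof -
    have "((\<lambda>x. x powr a) has_real_derivative a * x powr (a - 1)) (at x)"
      "((\<lambda>x. x powr - a) has_real_derivative - a * x powr (- a - 1)) (at x)"
      using has_real_derivative_powr[OF assms(2)] by blast+
    note [derivative_intros] = this
    have l0: "(1 - ln x)\<^sup>2 \<noteq> 0"
      using l by (auto simp: l_def)
    show ?thesis
      unfolding osc_def l_def s_def c_def p_def using assms l0
      by (auto intro!: derivative_eq_intros simp: power2_eq_square algebra_simps diff_divide_distrib)
  qed
  also have "((a * x powr (a - 1) * s + p * (c * (- a * x powr (- a - 1)))) * l\<^sup>2 - p * s * (2 * l * (- 1 / x))) / (l\<^sup>2 * l\<^sup>2) = D"
    unfolding D_def pm using p l assms by (simp add: field_simps power2_eq_square)
  finally have der: "(osc a has_real_derivative D) (at x)" .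
  have ps: "\<bar>p * s\<bar> \<le> 1"
    using p sc by (simp add: abs_mult mult_le_one)
  have "\<bar>a * p * s\<bar> \<le> a"
    using mult_left_mono[OF ps, of a] assms by (simp add: abs_mult mult_ac)
  moreover have "\<bar>a * c\<bar> \<le> a"
    using mult_left_mono[OF sc(2), of a] assms by (simp add: abs_mult)
  moreover have "\<bar>2 * p * s / l\<bar> \<le> 2"
    using ps l by (simp add: abs_mult field_simps)
  ultimately have "\<bar>a * p * s - a * c + 2 * p * s / l\<bar> \<le> 2 * a + 2"
    by linarith
  then have "\<bar>D\<bar> \<le> (2 * a + 2) / (x * l\<^sup>2)"
    unfolding D_def abs_divide using assms l by (simp add: abs_mult divide_right_mono)
  with der show ?thesis
    using that by (simp add: l_def)
qed

text \<open>The first bound serves the Hoelder estimate near 0; the second covers increments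
  starting at 0, where no derivative is at hand.\<close>

lemma abs_osc_le:
  assumes "0 < a" "0 \<le> x" "x \<le> 1"
  shows "\<bar>osc a x\<bar> \<le> x powr a" "\<bar>osc a x\<bar> \<le> osc_majorant a x"
proof -
  have "\<bar>osc a x\<bar> \<le> x powr a \<and> \<bar>osc a x\<bar> \<le> osc_majorant a x"
  proof (cases "x = 0")
    case True
    then show ?thesis by (simp add: osc_majorant_def)
  next
    case False
    define l where "l = 1 - ln x"
    have l: "1 \<le> l"
      using assms False by (simp add: l_def)
    then have l2: "l \<le> l\<^sup>2" "1 \<le> l\<^sup>2"
      by (auto simp: self_le_power one_le_power)
    have p: "0 \<le> x powr a" "x powr a \<le> 1"
      using assms by (auto simp: powr_le1)
    have num: "\<bar>x powr a * sin (x powr - a)\<bar> \<le> x powr a"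
      by (simp add: abs_mult mult_left_le)
    have eq: "\<bar>osc a x\<bar> = \<bar>x powr a * sin (x powr - a)\<bar> / l\<^sup>2"
      by (simp add: osc_def l_def abs_divide)
    have "\<bar>osc a x\<bar> \<le> x powr a / 1"
      unfolding eq using num l2 p by (intro frac_le) auto
    moreover have "\<bar>osc a x\<bar> \<le> (2 * a + 2) / l"
      unfolding eq using num l2 p l assms by (intro frac_le) auto
    ultimately show ?thesis
      using False by (simp add: osc_majorant_def l_def)
  qed
  then show "\<bar>osc a x\<bar> \<le> x powr a" "\<bar>osc a x\<bar> \<le> osc_majorant a x"
    by auto
qed

text \<open>For positive \<open>x\<close>, both \<open>osc_majorant a - osc a\<close> and
  \<open>osc_majorant a + osc a\<close> have nonnegative derivative by the derivative bound, hence
  are nondecreasing. For \<open>x = 0\<close> both functions vanish at \<open>x\<close> and the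
  pointwise bound suffices.\<close>

lemma osc_dominated:
  assumes "0 < a" "0 \<le> x" "x \<le> y" "y \<le> 1"
  shows "\<bar>osc a y - osc a x\<bar> \<le> osc_majorant a y - osc_majorant a x"
proof (cases "x = 0")
  case True
  then show ?thesis
    using abs_osc_le(2)[of a y] assms by (simp add: osc_majorant_def)
next
  case False
  have "osc_majorant a x - osc a x \<le> osc_majorant a y - osc a y"
  proof (rule DERIV_nonneg_imp_nondecreasing[OF assms(3)])
    fix z assume "x \<le> z" "z \<le> y"
    then have z: "0 < z" "z \<le> 1"
      using False assms by auto
    obtain D where "(osc a has_real_derivative D) (at z)" "\<bar>D\<bar> \<le> (2 * a + 2) / (z * (1 - ln z)\<^sup>2)"
      using osc_has_derivative[OF assms(1) z] .
    then show "\<exists>D. ((\<lambda>z. osc_majorant a z - osc a z) has_real_derivative D) (at z) \<and> 0 \<le> D"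
      using DERIV_diff[OF osc_majorant_has_derivative[OF z, of a]] by force
  qed
  moreover have "osc_majorant a x + osc a x \<le> osc_majorant a y + osc a y"
  proof (rule DERIV_nonneg_imp_nondecreasing[OF assms(3)])
    fix z assume "x \<le> z" "z \<le> y"
    then have z: "0 < z" "z \<le> 1"
      using False assms by auto
    obtain D where "(osc a has_real_derivative D) (at z)" "\<bar>D\<bar> \<le> (2 * a + 2) / (z * (1 - ln z)\<^sup>2)"
      using osc_has_derivative[OF assms(1) z] .
    then show "\<exists>D. ((\<lambda>z. osc_majorant a z + osc a z) has_real_derivative D) (at z) \<and> 0 \<le> D"
      using DERIV_add[OF osc_majorant_has_derivative[OF z, of a]] by force
  qed
  ultimately show ?thesis
    by linarith
qed

section \<open>Hoelder continuity of the oscillating function\<close>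

text \<open>Mean value theorem, with the logarithmic factor of the derivative bound estimated by
  1.\<close>

lemma osc_lipschitz_away_from_0:
  assumes "0 < a" "0 < x" "x \<le> y" "y \<le> 1"
  shows "\<bar>osc a y - osc a x\<bar> \<le> (2 * a + 2) / x * (y - x)"
proof (cases "x = y")
  case False
  have "\<exists>D. (osc a has_real_derivative D) (at z) \<and> \<bar>D\<bar> \<le> (2 * a + 2) / x"
    if z: "x \<le> z" "z \<le> y" for z
  proof -
    have z01: "0 < z" "z \<le> 1" using z assms by auto
    obtain D where D: "(osc a has_real_derivative D) (at z)" "\<bar>D\<bar> \<le> (2 * a + 2) / (z * (1 - ln z)\<^sup>2)"
      using osc_has_derivative[OF assms(1) z01] .
    have "1 \<le> (1 - ln z)\<^sup>2"
      using z01 by (simp add: one_le_power)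
    then have "x * 1 \<le> z * (1 - ln z)\<^sup>2"
      using z assms by (intro mult_mono) auto
    then have "(2 * a + 2) / (z * (1 - ln z)\<^sup>2) \<le> (2 * a + 2) / x"
      using assms z01 by (intro divide_left_mono mult_pos_pos) (auto simp: add_pos_nonneg)
    with D show ?thesis by force
  qed
  then obtain D where D: "\<And>z. x \<le> z \<Longrightarrow> z \<le> y \<Longrightarrow> (osc a has_real_derivative D z) (at z)"
      "\<And>z. x \<le> z \<Longrightarrow> z \<le> y \<Longrightarrow> \<bar>D z\<bar> \<le> (2 * a + 2) / x"
    by metis
  obtain z where "x < z" "z < y" "osc a y - osc a x = (y - x) * D z"
    using MVT2[of x y "osc a" D] D(1) False assms by auto
  then show ?thesis
    using mult_right_mono[OF D(2)[of z], of "y - x"] assms by (simp add: abs_mult mult.commute)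
qed simp

text \<open>The scale \<open>r\<close> with \<open>r powr (a + 1) = y - x\<close> balances two
  estimates: for \<open>x \<le> r\<close> the size of the values is of order
  \<open>r powr a\<close>, and for \<open>x > r\<close> the Lipschitz bound gives order
  \<open>(y - x) / r = r powr a\<close>. The constant adds those of the two cases.\<close>

lemma osc_holder_increment:
  assumes "0 < a" "0 \<le> x" "x \<le> y" "y \<le> 1"
  shows "\<bar>osc a y - osc a x\<bar> \<le> (2 * 2 powr a + 2 * a + 2) * (y - x) powr (a / (a + 1))"
proof (cases "x = y")
  case False
  define r where "r = (y - x) powr (1 / (a + 1))"
  have r: "0 < r" "r \<le> 1"
    using assms False by (auto simp: r_def powr_le1)
  have ra: "(y - x) powr (a / (a + 1)) = r powr a"
    by (simp add: r_def powr_powr)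
  have "r powr (a + 1) = y - x"
    using assms by (simp add: r_def powr_powr)
  then have d: "y - x = r * r powr a"
    using r by (simp add: powr_add mult.commute)
  show ?thesis
  proof (cases "x \<le> r")
    case True
    have "r powr a \<le> 1"
      using r assms by (simp add: powr_le1)
    \<comment> \<open>Hence \<open>y \<le> x + r \<le> 2 * r\<close>, the source of the factor
      \<open>2 powr a\<close>.\<close>
    then have "y - x \<le> r"
      unfolding d using r by (simp add: mult_left_le)
    then have "y powr a \<le> (2 * r) powr a"
      using assms True by (intro powr_mono2) auto
    then have "y powr a \<le> 2 powr a * r powr a"
      using r by (simp add: powr_mult)
    moreover have "\<bar>osc a y\<bar> \<le> y powr a" "\<bar>osc a x\<bar> \<le> x powr a"
      using abs_osc_le assms by auto
    moreover have "x powr a \<le> y powr a"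
      using assms by (intro powr_mono2) auto
    ultimately have "\<bar>osc a y - osc a x\<bar> \<le> 2 * (2 powr a * r powr a)"
      by linarith
    also have "\<dots> \<le> (2 * 2 powr a + 2 * a + 2) * r powr a"
      using assms by (simp add: algebra_simps)
    finally show ?thesis
      by (simp add: ra)
  next
    case False
    have "\<bar>osc a y - osc a x\<bar> \<le> (2 * a + 2) / x * (y - x)"
      using osc_lipschitz_away_from_0[of a x y] assms False r by auto
    also have "\<dots> \<le> (2 * a + 2) / r * (y - x)"
      using assms False r by (intro mult_right_mono divide_left_mono) auto
    also have "\<dots> = (2 * a + 2) * r powr a"
      unfolding d using r by simp
    also have "\<dots> \<le> (2 * 2 powr a + 2 * a + 2) * r powr a"
      by (intro mult_right_mono) auto
    finally show ?thesis
      by (simp add: ra)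
  qed
qed simp

lemma osc_holder_continuous_on:
  assumes "0 < a"
  shows "holder_continuous_on (a / (a + 1)) (osc a) 0 1"
  unfolding holder_continuous_on_def
proof (intro exI[of _ "2 * 2 powr a + 2 * a + 2"] conjI ballI)
  fix x y :: real assume "x \<in> {0..1}" "y \<in> {0..1}"
  then show "\<bar>osc a x - osc a y\<bar> \<le> (2 * 2 powr a + 2 * a + 2) * \<bar>x - y\<bar> powr (a / (a + 1))"
    using osc_holder_increment[OF assms, of x y] osc_holder_increment[OF assms, of y x]
    by (cases "x \<le> y") (auto simp: abs_minus_commute)
qed (use assms in auto)

section \<open>Finiteness of the variation\<close>

lemma variation_osc_le:
  assumes "0 < a" "x \<le> 1"
  shows "variation (osc a) 0 x \<le> ereal (osc_majorant a x)"
proof -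
  have "variation (osc a) 0 x \<le> ereal (osc_majorant a x - osc_majorant a 0)"
    using assms by (intro variation_le_of_dominated osc_dominated) auto
  then show ?thesis
    by (simp add: osc_majorant_def)
qed

lemma variation_fun_osc:
  assumes "0 < a" "0 \<le> x" "x \<le> 1"
  shows "ereal (variation_fun (osc a) 0 x) = variation (osc a) 0 x"
  unfolding variation_fun_def
  using variation_osc_le[OF assms(1,3)] variation_nonneg[OF assms(2), of "osc a"]
  by (intro ereal_real') auto

lemma variation_fun_osc_0:
  assumes "0 < a"
  shows "variation_fun (osc a) 0 0 = 0"
proof -
  have "variation (osc a) 0 0 = 0"
    using variation_osc_le[OF assms, of 0] variation_nonneg[of 0 0 "osc a"]
    by (intro antisym) (auto simp: osc_majorant_def zero_ereal_def)
  then show ?thesis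
    by (simp add: variation_fun_def)
qed

section \<open>Lower bound for the variation near 0\<close>

text \<open>The solution of \<open>x powr - a = pi * (j + 1 / 2)\<close>, where the sine in
  \<open>osc\<close> equals \<open>(- 1) ^ j\<close>; the points decrease to 0 as \<open>j\<close>
  grows.\<close>

definition peak :: "real \<Rightarrow> nat \<Rightarrow> real" where
  "peak a j = (pi * (real j + 1 / 2)) powr (- 1 / a)"

lemma peak_antimono:
  assumes "0 < a" "i \<le> j"
  shows "peak a j \<le> peak a i"
  unfolding peak_def using assms by (intro powr_mono2' mult_pos_pos) auto

lemma osc_peak:
  assumes "0 < a"
  shows "osc a (peak a j) =
    (- 1) ^ j / (pi * (real j + 1 / 2) * (1 + ln (pi * (real j + 1 / 2)) / a)\<^sup>2)"
proof -
  define u where "u = pi * (real j + 1 / 2)"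
  have u: "0 < u"
    by (simp add: u_def add_nonneg_pos)
  have "peak a j powr a = 1 / u" "peak a j powr - a = u" "ln (peak a j) = - ln u / a"
    using assms u by (auto simp: peak_def u_def[symmetric] powr_powr powr_minus_divide[of u 1] ln_powr)
  moreover have "sin u = (- 1) ^ j"
    by (simp add: u_def distrib_left sin_add mult.commute)
  ultimately show ?thesis
    by (simp add: osc_def u_def[symmetric] mult.commute)
qed

text \<open>Consecutive peaks have opposite signs, so each step between the peaks \<open>2 * N, \<dots>, N\<close>
  contributes at least the absolute value of the smallest of them.\<close>

lemma variation_fun_osc_ge:
  assumes "0 < a" "1 \<le> N" "peak a N \<le> 1"
  shows "1 / (2 * pi * (1 + ln (2 * pi * real N) / a)\<^sup>2) \<le> variation_fun (osc a) 0 (peak a N)"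
proof -
  \<comment> \<open>A common lower bound for the heights of the peaks \<open>j\<close> with
    \<open>N \<le> j < 2 * N\<close>, obtained from
    \<open>pi * (j + 1 / 2) \<le> 2 * pi * N\<close>.\<close>
  define m where "m = 1 / (2 * pi * real N * (1 + ln (2 * pi * real N) / a)\<^sup>2)"
  \<comment> \<open>Peaks decrease in their index, so it is reversed: the nodes are 0, then peak
    \<open>2 * N\<close> at \<open>i = 1\<close>, up to peak \<open>N\<close> at
    \<open>i = N + 1\<close>.\<close>
  define x where "x i = (if i = 0 then 0 else peak a (2 * N + 1 - i))" for i
  have step: "m \<le> \<bar>osc a (peak a j) - osc a (peak a (Suc j))\<bar>" if j: "N \<le> j" "j < 2 * N" for j
  proof -
    define v where "v k = 1 / (pi * (real k + 1 / 2) * (1 + ln (pi * (real k + 1 / 2)) / a)\<^sup>2)" for k :: nat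
    have v: "osc a (peak a k) = (- 1) ^ k * v k" for k
      using osc_peak[OF assms(1), of k] by (simp add: v_def)
    have v0: "0 \<le> v k" for k
      by (auto simp: v_def)
    define u where "u = pi * (real j + 1 / 2)"
    \<comment> \<open>With \<open>1 \<le> u\<close> the logarithm is nonnegative, so squaring below
      preserves the inequality.\<close>
    have "1 * 1 \<le> u"
      unfolding u_def using pi_gt3 j assms by (intro mult_mono) auto
    moreover have "u \<le> pi * (2 * real N)"
      unfolding u_def using j by (intro mult_left_mono) auto
    ultimately have u: "1 \<le> u" "u \<le> 2 * pi * real N"
      by (auto simp: mult_ac)
    then have l: "0 \<le> ln u / a" "ln u / a \<le> ln (2 * pi * real N) / a"
      using assms by (auto intro!: divide_right_mono)
    have "u * (1 + ln u / a)\<^sup>2 \<le> 2 * pi * real N * (1 + ln (2 * pi * real N) / a)\<^sup>2"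
      using u l by (intro mult_mono power_mono) auto
    moreover have "0 < u * (1 + ln u / a)\<^sup>2"
      using u l by (intro mult_pos_pos zero_less_power) auto
    ultimately have "m \<le> v j"
      unfolding m_def v_def u_def[symmetric] by (intro divide_left_mono) auto
    also have "\<dots> \<le> v j + v (Suc j)"
      using v0 by simp
    also have "\<dots> = \<bar>(- 1) ^ j * (v j + v (Suc j))\<bar>"
      using v0[of j] v0[of "Suc j"] by (simp add: abs_mult power_abs)
    finally show ?thesis
      by (simp add: v algebra_simps)
  qed
  \<comment> \<open>The \<open>N\<close> steps between peaks give \<open>N * m\<close>, which
    cancels the \<open>N\<close> in the denominator of \<open>m\<close>. The step from 0 to peak
    \<open>2 * N\<close> enters only later, as a nonnegative extra term.\<close>
  have "1 / (2 * pi * (1 + ln (2 * pi * real N) / a)\<^sup>2) = (\<Sum>i=2..N+1. m)"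
    using assms by (simp add: m_def)
  also have "\<dots> \<le> (\<Sum>i=2..N+1. \<bar>osc a (x i) - osc a (x (i - 1))\<bar>)"
  proof (intro sum_mono)
    fix i assume "i \<in> {2..N+1}"
    then show "m \<le> \<bar>osc a (x i) - osc a (x (i - 1))\<bar>"
      using step[of "2 * N + 1 - i"] by (auto simp: x_def Suc_diff_le)
  qed
  also have "\<dots> \<le> (\<Sum>i=1..N+1. \<bar>osc a (x i) - osc a (x (i - 1))\<bar>)"
    by (intro sum_mono2) auto
  finally have "ereal (1 / (2 * pi * (1 + ln (2 * pi * real N) / a)\<^sup>2))
      \<le> ereal (\<Sum>i=1..N+1. \<bar>osc a (x i) - osc a (x (i - 1))\<bar>)"
    by simp
  also have "\<dots> \<le> variation (osc a) 0 (peak a N)"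
  proof (intro sum_le_variation ballI)
    fix i assume "i \<in> {1..N+1}"
    then show "x (i - 1) \<le> x i"
      using peak_antimono[OF assms(1), of "2 * N + 1 - i" "2 * N + 1 - (i - 1)"]
      by (auto simp: x_def peak_def)
  qed (auto simp: x_def)
  also have "\<dots> = ereal (variation_fun (osc a) 0 (peak a N))"
    using assms by (subst variation_fun_osc) (auto simp: peak_def)
  finally show ?thesis
    by simp
qed

section \<open>Failure of Hoelder continuity and choice of the exponent\<close>

text \<open>A Hoelder bound between 0 and peak \<open>N\<close> would keep the reciprocal of a
  squared logarithm of \<open>N\<close> below a constant times a negative power of \<open>N\<close>,
  which fails for large \<open>N\<close>.\<close>

lemma variation_fun_osc_not_holder_continuous_on:
  assumes "0 < a" "0 < \<gamma>"
  shows "\<not> holder_continuous_on \<gamma> (variation_fun (osc a) 0) 0 1"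
proof
  assume "holder_continuous_on \<gamma> (variation_fun (osc a) 0) 0 1"
  then obtain L where L: "0 \<le> L" "\<And>x y. x \<in> {0..1} \<Longrightarrow> y \<in> {0..1} \<Longrightarrow>
      \<bar>variation_fun (osc a) 0 x - variation_fun (osc a) 0 y\<bar> \<le> L * \<bar>x - y\<bar> powr \<gamma>"
    unfolding holder_continuous_on_def by blast
  \<comment> \<open>This is the ratio of the supposed Hoelder bound at peak \<open>N\<close> to the
    lower bound for the variation there; a value below 1 is contradictory.\<close>
  have "(\<lambda>N. L * (pi * (real N + 1 / 2)) powr (- (\<gamma> / a)) * (2 * pi * (1 + ln (2 * pi * real N) / a)\<^sup>2))
      \<longlonglongrightarrow> 0"
    using assms by real_asymp
  then have "eventually (\<lambda>N. L * (pi * (real N + 1 / 2)) powr (- (\<gamma> / a)) *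
      (2 * pi * (1 + ln (2 * pi * real N) / a)\<^sup>2) < 1) sequentially"
    by (rule order_tendstoD) simp
  moreover have "eventually (\<lambda>N::nat. 1 \<le> N) sequentially"
    by (rule eventually_ge_at_top)
  ultimately have "eventually (\<lambda>N. False) sequentially"
  proof eventually_elim
    case (elim N)
    let ?q = "2 * pi * (1 + ln (2 * pi * real N) / a)\<^sup>2"
    have "1 * 1 \<le> pi * (real N + 1 / 2)"
      using pi_gt3 elim by (intro mult_mono) auto
    then have "peak a N \<le> 1 powr (- 1 / a)"
      unfolding peak_def using assms by (intro powr_mono2') auto
    then have p: "0 \<le> peak a N" "peak a N \<le> 1"
      by (auto simp: peak_def)
    have "1 * 1 \<le> 2 * pi * real N"
      using pi_gt3 elim by (intro mult_mono) auto
    then have q: "0 < ?q"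
      using assms by (intro mult_pos_pos zero_less_power add_pos_nonneg) auto
    have "1 / ?q \<le> variation_fun (osc a) 0 (peak a N)"
      using assms elim p by (intro variation_fun_osc_ge) auto
    also have "\<dots> \<le> L * peak a N powr \<gamma>"
      using L(2)[of "peak a N" 0] p variation_fun_osc_0[OF assms(1)] by simp
    also have "peak a N powr \<gamma> = (pi * (real N + 1 / 2)) powr (- (\<gamma> / a))"
      by (simp add: peak_def powr_powr)
    finally show False
      using elim(1) q by (simp add: field_simps)
  qed
  then show False
    by simp
qed

theorem mainTheorem2:
  fixes \<alpha> :: real
  assumes "0 < \<alpha>" and "\<alpha> < 1"
  shows "\<exists>f :: real \<Rightarrow> real.
           bounded_variation_on f 0 1 \<and>
           holder_continuous_on \<alpha> f 0 1 \<and>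
           (\<forall>\<gamma>. 0 < \<gamma> \<and> \<gamma> < 1 \<longrightarrow> \<not> holder_continuous_on \<gamma> (variation_fun f 0) 0 1)"
proof -
  \<comment> \<open>The solution of \<open>a / (a + 1) = \<alpha>\<close>, which makes the Hoelder
    exponent of \<open>osc a\<close> equal to \<alpha>.\<close>
  define a where "a = \<alpha> / (1 - \<alpha>)"
  have a: "0 < a" "a / (a + 1) = \<alpha>"
    using assms by (auto simp: a_def field_simps)
  have "bounded_variation_on (osc a) 0 1"
    unfolding bounded_variation_on_def using variation_osc_le[OF a(1), of 1]
    by (rule le_less_trans) auto
  moreover have "holder_continuous_on \<alpha> (osc a) 0 1"
    using osc_holder_continuous_on[OF a(1)] by (simp add: a(2))
  ultimately show ?thesis
    using variation_fun_osc_not_holder_continuous_on[OF a(1)] by blast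
qed

end
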